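(* Let $\mu$ be a non-trivial probability measure supported on $[-1,1]$ with recurrence coefficients $\{b_n\}_{n\ge1}$, $\{d_n\}_{n\ge1}$, and let $\sigma=\mathrm{Sz}(\mu)$ have Verblunsky coefficients $\{\alpha_n\}_{n\ge0}$. Let $k\ge1$, let $\xi_0,\dots,\xi_{k-1}\in(-1,1)$, and let $\{\Phi^{(-k)}_n\}_{n\ge0}$ be the anti-associated polynomials of order $k$ on the unit circle, i.e. the monic orthogonal polynomials with Verblunsky coefficients $\tilde\alpha_n=\xi_n$ for $0\le n\le k-1$ and $\tilde\alpha_n=\alpha_{n-k}$ for $n\ge k$ (with $\tilde\alpha_{-1}=-1$). Let $\{\tilde b_n\}_{n\ge1}$, $\{\tilde d_n\}_{n\ge1}$ be the recurrence coefficients of the orthogonal polynomials on the real line corresponding to $\{\Phi_n^{(-k)}\}_{n\ge0}$ through the Szegő transformation. Let $m\ge1$ be an integer. (i) If $k=2m-1$, then $$\tilde d_{n+1}=\begin{cases}\frac12(1-\xi_0^2)(1+\tilde\alpha_1),&n=0,\\ \frac14(1-\xi_{2n-1})(1-\xi_{2n}^2)(1+\xi_{2n+1}),&1\le n\le m-2,\\ \frac14(1-\xi_{2n-1})(1-\xi_{2n}^2)(1+\alpha_{2(n-m)+2}),&n=m-1\ge1,\\ \frac14(1-\alpha_{2(n-m)})(1-\alpha_{2(n-m)+1}^2)(1+\alpha_{2(n-m)+2}),&n\ge m,\end{cases}$$ where $\tilde\alpha_1=\xi_1$ if $m\ge2$ and $\tilde\alpha_1=\alpha_0$ if $m=1$,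 and $$\tilde b_{n+1}=\begin{cases}\xi_0,&n=0,\\ \frac12[(1-\xi_{2n-1})\xi_{2n}-(1+\xi_{2n-1})\xi_{2n-2}],&1\le n\le m-1,\\ \frac12[(1-\alpha_{2(n-m)})\alpha_{2(n-m)+1}-(1+\alpha_{2(n-m)})\xi_{2n-2}],&n=m,\\ \frac12[(1-\alpha_{2(n-m)})\alpha_{2(n-m)+1}-(1+\alpha_{2(n-m)})\alpha_{2(n-m)-1}],&n>m.\end{cases}$$ (ii) If $k=2m$, then $$\tilde d_{n+1}=\begin{cases}\frac12(1-\xi_0^2)(1+\xi_1),&n=0,\\ \frac14(1-\xi_{2n-1})(1-\xi_{2n}^2)(1+\xi_{2n+1}),&1\le n\le m-1,\\ \frac14(1-\xi_{2n-1})(1-\alpha_{2(n-m)}^2)(1+\alpha_{2(n-m)+1}),&n=m,\\ d_{n-m+1},&n>m,\end{cases}$$ $$\tilde b_{n+1}=\begin{cases}\xi_0,&n=0,\\ \frac12[(1-\xi_{2n-1})\xi_{2n}-(1+\xi_{2n-1})\xi_{2n-2}],&1\le n\le m-1,\\ \frac12[(1-\xi_{2n-1})\alpha_{2(n-m)}-(1+\xi_{2n-1})\xi_{2n-2}],&n=m,\\ b_{n-m+1},&n>m.\end{cases}$$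
   Context: For a non-trivial probability measure on $[-1,1]$, the recurrence coefficients $b_n\in\mathbb R$, $d_n>0$ ($n\ge1$) are those of its monic orthogonal polynomials: $P_{n+1}(x)=(x-b_{n+1})P_n(x)-d_nP_{n-1}(x)$, $n\ge0$, $P_{-1}=0$, $P_0=1$. For a non-trivial probability measure on the unit circle with monic orthogonal polynomials $\Phi_n$, the Verblunsky coefficients are $\alpha_n=-\overline{\Phi_{n+1}(0)}$, $n\ge0$, and $\Phi_{n+1}(z)=z\Phi_n(z)-\overline{\alpha_n}\Phi_n^*(z)$, $\Phi_0=1$, with $\Phi_n^*(z)=z^n\overline{\Phi_n(1/\bar z)}$. Szegő transformation: a probability measure $\nu$ on $[-1,1]$ is sent to the probability measure $\mathrm{Sz}(\nu)$ on the unit circle given by $d\,\mathrm{Sz}(\nu)(\theta)=\frac12|d\nu(\cos\theta)|$, i.e. the measure invariant under $\theta\mapsto-\theta$ whose push-forward under $e^{i\theta}\mapsto\cos\theta$ is $\nu$. Its Verblunsky coefficients are in $(-1,1)$, and each probability measure on the circle with all Verblunsky coefficients in $(-1,1)$ is $\mathrm{Sz}(\nu)$ for a unique $\nu$. The coefficients $\tilde b_n,\tilde d_n$ are those of the measure $\tilde\mu$ on $[-1,1]$ such that $\mathrm{Sz}(\tilde\mu)$ has Verblunsky coefficients $\{\tilde\alpha_n\}_{n\ge0}$. *)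

theory Defs
  imports
    "HOL-Analysis.Analysis"
    "HOL-Probability.Probability"
    "HOL-Computational_Algebra.Polynomial"
begin

definition nontrivial_prob_on :: "'a::t2_space set \<Rightarrow> 'a measure \<Rightarrow> bool" where
  "nontrivial_prob_on S M \<longleftrightarrow>
     prob_space M \<and> sets M = sets borel \<and> (AE x in M. x \<in> S) \<and>
     (\<forall>F. finite F \<longrightarrow> \<not> (AE x in M. x \<in> F))"

definition monic_oprl :: "real measure \<Rightarrow> (nat \<Rightarrow> real poly) \<Rightarrow> bool" where
  "monic_oprl \<mu> P \<longleftrightarrow>
     (\<forall>n. degree (P n) = n \<and> lead_coeff (P n) = 1) \<and>
     (\<forall>m n. m \<noteq> n \<longrightarrow> (\<integral>x. poly (P m) x * poly (P n) x \<partial>\<mu>) = 0)"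

text \<open>Only the values of \<open>b\<close> and \<open>d\<close> at indices at least 1 are constrained:
  for \<open>n = 0\<close> the last summand is \<open>d 0\<close> times the zero polynomial.\<close>

definition recurrence_coeffs ::
  "real measure \<Rightarrow> (nat \<Rightarrow> real) \<Rightarrow> (nat \<Rightarrow> real) \<Rightarrow> bool" where
  "recurrence_coeffs \<mu> b d \<longleftrightarrow>
     (\<exists>P. monic_oprl \<mu> P \<and>
        (\<forall>n. P (n + 1) =
           [:- b (n + 1), 1:] * P n - smult (d n) (if n = 0 then 0 else P (n - 1))))"

definition monic_opuc :: "complex measure \<Rightarrow> (nat \<Rightarrow> complex poly) \<Rightarrow> bool" where
  "monic_opuc \<sigma> \<Phi> \<longleftrightarrow>
     (\<forall>n. degree (\<Phi> n) = n \<and> lead_coeff (\<Phi> n) = 1) \<and>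
     (\<forall>m n. m \<noteq> n \<longrightarrow> (\<integral>z. cnj (poly (\<Phi> m) z) * poly (\<Phi> n) z \<partial>\<sigma>) = 0)"

definition verblunsky :: "(nat \<Rightarrow> complex poly) \<Rightarrow> nat \<Rightarrow> complex" where
  "verblunsky \<Phi> n = - cnj (poly (\<Phi> (n + 1)) 0)"

definition verblunsky_coeffs :: "complex measure \<Rightarrow> (nat \<Rightarrow> complex) \<Rightarrow> bool" where
  "verblunsky_coeffs \<sigma> \<alpha> \<longleftrightarrow> (\<exists>\<Phi>. monic_opuc \<sigma> \<Phi> \<and> (\<forall>n. \<alpha> n = verblunsky \<Phi> n))"

text \<open>Half of the mass of \<open>\<nu>\<close> at \<open>x = cos \<theta>\<close> is placed at each of
  \<open>\<theta> = arccos x\<close> and \<open>\<theta> = - arccos x\<close>.  The lemmas after the definition show that the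
  result is the probability measure on the unit circle that is invariant under complex conjugation
  and whose image under \<open>Re\<close> is \<open>\<nu>\<close>, and that these properties determine it.\<close>

definition Szego :: "real measure \<Rightarrow> complex measure" where
  "Szego \<nu> = measure_of UNIV (sets borel)
     (\<lambda>A. (emeasure \<nu> {x. cis (arccos x) \<in> A} + emeasure \<nu> {x. cis (- arccos x) \<in> A}) / 2)"

lemma sets_Szego [simp]: "sets (Szego \<nu>) = sets borel"
  and space_Szego [simp]: "space (Szego \<nu>) = UNIV"
  unfolding Szego_def by (simp_all add: sets_measure_of_conv space_measure_of_conv
    sets.sigma_sets_eq[of borel, simplified])

lemma borel_measurable_arccos: "arccos \<in> borel_measurable borel"
proof -
  define c :: real where "c = (THE y. False)"
  have "arccos = (\<lambda>x. if x \<in> {-1..1} then arccos x else c)"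
  proof (rule ext)
    fix x :: real
    show "arccos x = (if x \<in> {-1..1} then arccos x else c)"
    proof (cases "x \<in> {-1..1}")
      case False
      then have "(0 \<le> y \<and> y \<le> pi \<and> cos y = x) = False" for y
        using cos_le_one[of y] cos_ge_minus_one[of y] by auto
      then have "arccos x = c"
        unfolding arccos_def c_def by (simp only:)
      with False show ?thesis by simp
    qed auto
  qed
  moreover have "(\<lambda>x. if x \<in> {-1..1} then arccos x else c) \<in> borel_measurable borel"
    by (rule borel_measurable_continuous_on_if) (auto intro: continuous_on_arccos')
  ultimately show ?thesis by (simp only:)
qed

lemma borel_measurable_cis_arccos:
  "(\<lambda>x. cis (arccos x)) \<in> borel_measurable borel"
  "(\<lambda>x. cis (- arccos x)) \<in> borel_measurable borel"
proof -
  have cis: "cis \<in> borel_measurable borel"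
    by (intro borel_measurable_continuous_onI continuous_intros)
  show "(\<lambda>x. cis (arccos x)) \<in> borel_measurable borel"
    using measurable_compose[OF borel_measurable_arccos cis] .
  show "(\<lambda>x. cis (- arccos x)) \<in> borel_measurable borel"
    using measurable_compose[OF borel_measurable_uminus[OF borel_measurable_arccos] cis] .
qed

lemma emeasure_Szego:
  assumes "sets \<nu> = sets borel" and A: "A \<in> sets borel"
  shows "emeasure (Szego \<nu>) A =
    (emeasure \<nu> {x. cis (arccos x) \<in> A} + emeasure \<nu> {x. cis (- arccos x) \<in> A}) / 2"
proof -
  define f g :: "real \<Rightarrow> complex" where "f = (\<lambda>x. cis (arccos x))" and "g = (\<lambda>x. cis (- arccos x))"
  have m [measurable]: "f \<in> \<nu> \<rightarrow>\<^sub>M borel" "g \<in> \<nu> \<rightarrow>\<^sub>M borel"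
    using borel_measurable_cis_arccos measurable_cong_sets[OF assms(1) refl]
    unfolding f_def g_def by auto
  have sp: "space \<nu> = UNIV"
    using sets_eq_imp_space_eq[OF assms(1)] by simp
  have eq: "(emeasure \<nu> {x. f x \<in> B} + emeasure \<nu> {x. g x \<in> B}) / 2 =
      (emeasure (distr \<nu> borel f) B + emeasure (distr \<nu> borel g) B) / 2"
    if "B \<in> sets borel" for B
    using that by (simp add: emeasure_distr sp vimage_def)
  have "countably_additive (sets borel)
      (\<lambda>B. (emeasure \<nu> {x. f x \<in> B} + emeasure \<nu> {x. g x \<in> B}) / 2)"
  proof (rule countably_additiveI)
    fix B :: "nat \<Rightarrow> complex set"
    assume B: "range B \<subseteq> sets borel" "disjoint_family B" "(\<Union>i. B i) \<in> sets borel"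
    have Bi: "B i \<in> sets borel" for i using B by auto
    have "(\<Sum>i. (emeasure \<nu> {x. f x \<in> B i} + emeasure \<nu> {x. g x \<in> B i}) / 2) =
        (\<Sum>i. emeasure (distr \<nu> borel f) (B i) + emeasure (distr \<nu> borel g) (B i)) / 2"
      using Bi by (simp add: eq ennreal_suminf_divide)
    also have "\<dots> = ((\<Sum>i. emeasure (distr \<nu> borel f) (B i)) +
        (\<Sum>i. emeasure (distr \<nu> borel g) (B i))) / 2"
      by (simp add: suminf_add[symmetric] summableI)
    also have "\<dots> = (emeasure (distr \<nu> borel f) (\<Union>i. B i) +
        emeasure (distr \<nu> borel g) (\<Union>i. B i)) / 2"
      using B by (simp add: suminf_emeasure)
    finally show "(\<Sum>i. (emeasure \<nu> {x. f x \<in> B i} + emeasure \<nu> {x. g x \<in> B i}) / 2) =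
        (emeasure \<nu> {x. f x \<in> (\<Union>i. B i)} + emeasure \<nu> {x. g x \<in> (\<Union>i. B i)}) / 2"
      by (simp only: eq[OF B(3)])
  qed
  moreover have "positive (sets borel)
      (\<lambda>B. (emeasure \<nu> {x. f x \<in> B} + emeasure \<nu> {x. g x \<in> B}) / 2)"
    by (simp add: positive_def)
  moreover have "sigma_algebra UNIV (sets (borel :: complex measure))"
    using sets.sigma_algebra_axioms[of "borel :: complex measure"] by simp
  ultimately show ?thesis
    using A emeasure_measure_of_sigma unfolding Szego_def f_def g_def by blast
qed

context
  fixes \<nu> :: "real measure"
  assumes \<nu>: "prob_space \<nu>" "sets \<nu> = sets borel" "AE x in \<nu>. x \<in> {-1..1}"
begin

lemma prob_space_Szego: "prob_space (Szego \<nu>)"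
proof
  interpret prob_space \<nu> by (fact \<nu>)
  have "emeasure \<nu> UNIV = 1"
    using emeasure_space_1 sets_eq_imp_space_eq[OF \<nu>(2)] by simp
  then show "emeasure (Szego \<nu>) (space (Szego \<nu>)) = 1"
    by (simp add: emeasure_Szego[OF \<nu>(2)])
qed

lemma AE_Szego: "AE z in Szego \<nu>. norm z = 1"
proof -
  have m: "{z :: complex. norm z \<noteq> 1} \<in> sets borel"
    by measurable
  then have "emeasure (Szego \<nu>) {z. norm z \<noteq> 1} = 0"
    by (simp add: emeasure_Szego[OF \<nu>(2)])
  with m show ?thesis
    by (intro AE_I[of _ _ "{z. norm z \<noteq> 1}"]) auto
qed

lemma distr_cnj_Szego: "distr (Szego \<nu>) borel cnj = Szego \<nu>"
proof (rule measure_eqI)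
  have c: "cnj \<in> borel_measurable borel"
    by (intro borel_measurable_continuous_onI continuous_intros)
  fix A assume "A \<in> sets (distr (Szego \<nu>) borel cnj)"
  then have A: "A \<in> sets borel" by simp
  then have A': "cnj -` A \<in> sets borel"
    using measurable_sets[OF c A] by simp
  have "emeasure (distr (Szego \<nu>) borel cnj) A = emeasure (Szego \<nu>) (cnj -` A)"
    using A c by (subst emeasure_distr) (simp_all cong: measurable_cong_sets)
  also have "\<dots> = emeasure (Szego \<nu>) A"
    by (simp add: emeasure_Szego[OF \<nu>(2)] A A' cis_cnj add.commute)
  finally show "emeasure (distr (Szego \<nu>) borel cnj) A = emeasure (Szego \<nu>) A" .
qed simp

lemma distr_Re_Szego: "distr (Szego \<nu>) borel Re = \<nu>"
proof (rule measure_eqI)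
  fix A assume "A \<in> sets (distr (Szego \<nu>) borel Re)"
  then have A: "A \<in> sets borel" by simp
  then have A': "Re -` A \<in> sets borel"
    using measurable_sets[OF borel_measurable_Re A] by simp
  have m: "(\<lambda>x. cos (arccos x)) \<in> \<nu> \<rightarrow>\<^sub>M borel"
    using measurable_compose[OF borel_measurable_cis_arccos(1) borel_measurable_Re]
    by (simp cong: measurable_cong_sets add: \<nu>(2))
  have "{x. cos (arccos x) \<in> A} = (\<lambda>x. cos (arccos x)) -` A \<inter> space \<nu>"
    using sets_eq_imp_space_eq[OF \<nu>(2)] by auto
  then have s: "{x. cos (arccos x) \<in> A} \<in> sets \<nu>"
    using measurable_sets[OF m A] by simp
  have *: "emeasure \<nu> {x. cos (arccos x) \<in> A} = emeasure \<nu> A"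
    using \<nu>(3) s A \<nu>(2) by (intro emeasure_eq_AE) (auto elim: eventually_mono simp: cos_arccos)
  have "emeasure (distr (Szego \<nu>) borel Re) A = emeasure (Szego \<nu>) (Re -` A)"
    using A by (subst emeasure_distr) (simp_all cong: measurable_cong_sets)
  also have "\<dots> = (emeasure \<nu> A + emeasure \<nu> A) / 2"
    by (simp add: emeasure_Szego[OF \<nu>(2)] A' *)
  also have "\<dots> = emeasure \<nu> A"
    unfolding mult_2_right[symmetric] by (rule ennreal_mult_divide_eq) simp_all
  finally show "emeasure (distr (Szego \<nu>) borel Re) A = emeasure \<nu> A" .
qed (simp add: \<nu>(2))

lemma Szego_unique:
  assumes \<sigma>: "sets \<sigma> = sets borel" "AE z in \<sigma>. norm z = 1"
    "distr \<sigma> borel cnj = \<sigma>" "distr \<sigma> borel Re = \<nu>"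
  shows "\<sigma> = Szego \<nu>"
proof (rule measure_eqI)
  have c: "cnj \<in> \<sigma> \<rightarrow>\<^sub>M borel" and r: "Re \<in> \<sigma> \<rightarrow>\<^sub>M borel"
    using borel_measurable_continuous_onI[OF continuous_on_cnj[OF continuous_on_id]]
    by (simp_all add: \<sigma>(1) cong: measurable_cong_sets)
  have sp: "space \<sigma> = UNIV" "space \<nu> = UNIV"
    using sets_eq_imp_space_eq[OF \<sigma>(1)] sets_eq_imp_space_eq[OF \<nu>(2)] by auto
  fix A assume "A \<in> sets \<sigma>"
  then have A: "A \<in> sets borel" by (simp add: \<sigma>(1))
  let ?f = "\<lambda>x. cis (arccos x)" and ?g = "\<lambda>x. cis (- arccos x)"
  have mf: "{x. ?f x \<in> A} \<in> sets borel" "{x. ?g x \<in> A} \<in> sets borel"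
    using measurable_sets[OF borel_measurable_cis_arccos(1) A]
      measurable_sets[OF borel_measurable_cis_arccos(2) A]
    by (simp_all add: vimage_def)
  have mz: "(\<lambda>z. indicator A z :: ennreal) \<in> borel_measurable borel"
    using A by simp
  have "2 * emeasure \<sigma> A = (\<integral>\<^sup>+z. indicator A z \<partial>\<sigma>) + (\<integral>\<^sup>+z. indicator A z \<partial>distr \<sigma> borel cnj)"
    using A \<sigma>(1) by (simp add: \<sigma>(3) mult_2)
  also have "(\<integral>\<^sup>+z. indicator A z \<partial>distr \<sigma> borel cnj) = (\<integral>\<^sup>+z. indicator A (cnj z) \<partial>\<sigma>)"
    using mz by (intro nn_integral_distr c) simp
  also have "(\<integral>\<^sup>+z. indicator A z \<partial>\<sigma>) + (\<integral>\<^sup>+z. indicator A (cnj z) \<partial>\<sigma>) =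
      (\<integral>\<^sup>+z. indicator A z + indicator A (cnj z) \<partial>\<sigma>)"
    using A \<sigma>(1) measurable_compose[OF c mz] by (intro nn_integral_add[symmetric]) auto
  also have "\<dots> = (\<integral>\<^sup>+z. indicator A (?f (Re z)) + indicator A (?g (Re z)) \<partial>\<sigma>)"
  proof (rule nn_integral_cong_AE)
    have "indicator A z + indicator A (cnj z) =
        (indicator A (?f (Re z)) + indicator A (?g (Re z)) :: ennreal)" if "norm z = 1" for z
    proof -
      have z: "\<bar>Re z\<bar> \<le> 1" "Re z ^ 2 + Im z ^ 2 = 1"
        using that abs_Re_le_cmod[of z] cmod_power2[of z] by auto
      then have "sqrt (1 - Re z ^ 2) = \<bar>Im z\<bar>"
        by (metis add_diff_cancel_left' real_sqrt_abs)
      then have "?f (Re z) = Complex (Re z) \<bar>Im z\<bar>" "?g (Re z) = Complex (Re z) (- \<bar>Im z\<bar>)"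
        using z(1) by (auto simp: complex_eq_iff cos_arccos_abs sin_arccos_abs)
      then have "?f (Re z) = z \<and> ?g (Re z) = cnj z \<or> ?f (Re z) = cnj z \<and> ?g (Re z) = z"
        by (auto simp: complex_eq_iff abs_if)
      then show ?thesis by (auto simp: add.commute)
    qed
    then show "AE z in \<sigma>. indicator A z + indicator A (cnj z) =
        (indicator A (?f (Re z)) + indicator A (?g (Re z)) :: ennreal)"
      using \<sigma>(2) by (auto elim: eventually_mono)
  qed
  also have "\<dots> = (\<integral>\<^sup>+x. indicator A (?f x) + indicator A (?g x) \<partial>distr \<sigma> borel Re)"
    using measurable_compose[OF borel_measurable_cis_arccos(1) mz]
      measurable_compose[OF borel_measurable_cis_arccos(2) mz]
    by (intro nn_integral_distr[symmetric] r) simp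
  also have "\<dots> = (\<integral>\<^sup>+x. indicator {x. ?f x \<in> A} x + indicator {x. ?g x \<in> A} x \<partial>\<nu>)"
    by (simp add: \<sigma>(4) indicator_def)
  also have "\<dots> = emeasure \<nu> {x. ?f x \<in> A} + emeasure \<nu> {x. ?g x \<in> A}"
    using mf by (subst nn_integral_add) (simp_all add: \<nu>(2) borel_measurable_indicator)
  finally have "2 * emeasure \<sigma> A / 2 = emeasure (Szego \<nu>) A"
    by (simp add: emeasure_Szego[OF \<nu>(2) A])
  then show "emeasure \<sigma> A = emeasure (Szego \<nu>) A"
    by (simp add: ennreal_mult_divide_eq mult.commute[of 2])
qed (simp add: \<sigma>(1))

end

definition anti_associated_verblunsky ::
  "nat \<Rightarrow> (nat \<Rightarrow> real) \<Rightarrow> (nat \<Rightarrow> real) \<Rightarrow> nat \<Rightarrow> real" where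
  "anti_associated_verblunsky k \<xi> \<alpha> n = (if n < k then \<xi> n else \<alpha> (n - k))"

end

theory Submission
  imports Defs
begin

text \<open>
  On the unit circle put \<open>X\<^sub>n = \<Phi>\<^sub>n(z)\<close> and \<open>Y\<^sub>n = z\<^sup>n cnj X\<^sub>n\<close>.  For real Verblunsky coefficients
  the Szego recursion makes \<open>S\<^sub>n = z X\<^bsub>2n-1\<^esub> + Y\<^bsub>2n-1\<^esub>\<close> (and \<open>S\<^sub>0 = 1\<close>) satisfy a three-term recursion
  whose coefficients are given by the Geronimus formulas, so that \<open>S\<^sub>n = (2z)\<^sup>n Q\<^sub>n(Re z)\<close> for the
  monic polynomials \<open>Q\<^sub>n\<close> generated by these formulas.  Orthogonality of \<open>\<Phi>\<^bsub>2n-1\<^esub>\<close> to all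
  polynomials of lower degree makes \<open>Q\<^sub>n\<close> orthogonal to lower degrees with respect to the measure on
  \<open>[-1,1]\<close>, so the Geronimus formulas give its recurrence coefficients.  The theorem is
  the Geronimus formulas for the shifted Verblunsky sequence.\<close>

section \<open>Polynomials and orthogonality\<close>

text \<open>Subtracting \<open>lead_coeff p\<close> times the member of degree
  \<open>degree p\<close> lowers the degree, so the members below n span all polynomials of degree
  below n. The single closure rule \<open>add\<close> also suits properties conjugate-linear in the
  polynomial.\<close>

lemma monic_family_induct [consumes 2, case_names zero add base]:
  fixes p :: "'a::comm_ring_1 poly" and \<Phi> :: "nat \<Rightarrow> 'a poly"
  assumes \<Phi>: "\<forall>m. degree (\<Phi> m) = m \<and> lead_coeff (\<Phi> m) = 1"
    and "degree p < n"
    and zero: "V 0"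
    and add: "\<And>c p q. V p \<Longrightarrow> V q \<Longrightarrow> V (smult c p + q)"
    and base: "\<And>m. m < n \<Longrightarrow> V (\<Phi> m)"
  shows "V p"
  using assms(2)
proof (induction "degree p" arbitrary: p rule: less_induct)
  case less
  let ?d = "degree p"
  let ?q = "p - smult (lead_coeff p) (\<Phi> ?d)"
  have le: "degree ?q \<le> ?d"
    using \<Phi> by (intro degree_diff_le) (auto intro: order_trans[OF degree_smult_le])
  have co: "coeff ?q ?d = 0"
    using \<Phi>[rule_format, of ?d] by (metis coeff_diff coeff_smult mult.right_neutral right_minus_eq)
  have "V ?q"
  \<comment> \<open>For constant \<open>p\<close> the degree cannot drop; there \<open>?q\<close>
    vanishes, and the hypothesis \<open>zero\<close> takes over.\<close>
  proof (cases "?q = 0")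
    case True
    then show ?thesis using zero by (simp only:)
  next
    case False
    then have "degree ?q \<noteq> ?d" using co leading_coeff_neq_0 by metis
    then have "degree ?q < ?d" using le by simp
    then show ?thesis using less by simp
  qed
  from add[OF base[OF less.prems] this, of "lead_coeff p"] show ?case by simp
qed

section \<open>Non-trivial measures: vanishing of polynomials and integrability\<close>

text \<open>A nonzero polynomial has finitely many roots, and these cannot carry all the mass. This
  turns a vanishing square integral into a polynomial identity.\<close>

lemma AE_poly_eq_0:
  fixes p :: "'a::{idom,t2_space} poly"
  assumes "nontrivial_prob_on S M" and "AE x in M. poly p x = 0"
  shows "p = 0"
  using assms poly_roots_finite[of p] unfolding nontrivial_prob_on_def by fastforce

text \<open>If \<open>Szego \<nu>\<close> lived on a finite set \<open>F\<close>, then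
  \<open>\<nu>\<close>, its push-forward under \<open>Re\<close>, would live on the finite image of
  \<open>F\<close>.\<close>

lemma nontrivial_prob_on_Szego:
  assumes "nontrivial_prob_on {-1..1} \<nu>"
  shows "nontrivial_prob_on {z. norm z = 1} (Szego \<nu>)"
proof -
  have \<nu>: "prob_space \<nu>" "sets \<nu> = sets borel" "AE x in \<nu>. x \<in> {-1..1}"
    using assms by (auto simp: nontrivial_prob_on_def)
  have "\<not> (AE z in Szego \<nu>. z \<in> F)" if F: "finite F" for F
  proof
    assume "AE z in Szego \<nu>. z \<in> F"
    then have "AE z in Szego \<nu>. Re z \<in> Re ` F" by (auto elim: eventually_mono)
    moreover have "Re \<in> Szego \<nu> \<rightarrow>\<^sub>M borel"
      using borel_measurable_Re by (simp cong: measurable_cong_sets)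
    moreover have "{x \<in> space borel. x \<in> Re ` F} \<in> sets borel"
      using F by (simp add: borel_closed finite_imp_closed)
    ultimately have "AE x in distr (Szego \<nu>) borel Re. x \<in> Re ` F"
      by (subst AE_distr_iff) auto
    then have "AE x in \<nu>. x \<in> Re ` F"
      by (simp only: distr_Re_Szego[OF \<nu>])
    then show False using assms F by (auto simp: nontrivial_prob_on_def)
  qed
  then show ?thesis
    using prob_space_Szego[OF \<nu>] AE_Szego[OF \<nu>] by (simp add: nontrivial_prob_on_def)
qed

text \<open>The function is bounded on the compact set that carries the mass, and continuity on the
  whole space gives measurability. Serves both the interval and the circle.\<close>

lemma integrable_continuous_nontrivial_prob_on:
  fixes f :: "'a::t2_space \<Rightarrow> 'b::{banach,second_countable_topology}"
  assumes M: "nontrivial_prob_on S M" and "compact S" and f: "continuous_on UNIV f"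
  shows "integrable M f"
proof -
  interpret prob_space M using M by (simp add: nontrivial_prob_on_def)
  have "compact (f ` S)"
    using assms by (intro compact_continuous_image) (auto intro: continuous_on_subset)
  then obtain B where B: "\<And>x. x \<in> S \<Longrightarrow> norm (f x) \<le> B"
    using compact_imp_bounded bounded_iff by (metis imageI)
  have "AE x in M. x \<in> S" "sets M = sets borel"
    using M by (auto simp: nontrivial_prob_on_def)
  then show ?thesis
    using B borel_measurable_continuous_onI[OF f]
    by (intro integrable_const_bound[of _ B])
      (auto elim: eventually_mono cong: measurable_cong_sets)
qed

lemma compact_unit_circle: "compact {z :: complex. norm z = 1}"
  using compact_sphere[of "0::complex" 1] by (simp add: sphere_def)

section \<open>Orthogonality to lower degrees and uniqueness\<close>

lemma monic_oprl_integral_lower_degree: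
  assumes \<mu>: "nontrivial_prob_on {-1..1} \<mu>" and P: "monic_oprl \<mu> P" and "degree p < n"
  shows "(\<integral>x. poly p x * poly (P n) x \<partial>\<mu>) = 0"
proof -
  have "\<forall>m. degree (P m) = m \<and> lead_coeff (P m) = 1"
    using P unfolding monic_oprl_def by blast
  then show ?thesis using \<open>degree p < n\<close>
  proof (induction rule: monic_family_induct)
    case (add c p q)
    have "integrable \<mu> (\<lambda>x. poly r x * poly (P n) x)" for r
      by (intro integrable_continuous_nontrivial_prob_on[OF \<mu>] continuous_intros) auto
    moreover have "(\<lambda>x. poly (smult c p + q) x * poly (P n) x) =
        (\<lambda>x. c * (poly p x * poly (P n) x) + poly q x * poly (P n) x)"
      by (simp add: algebra_simps)
    ultimately show ?case using add by simp
  qed (use P in \<open>auto simp: monic_oprl_def\<close>)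
qed

text \<open>For n > 0 the difference of \<open>P n\<close> and \<open>Q\<close> has degree below n,
  so it is orthogonal to both, hence to itself, and its square integrates to zero. For n = 0 both
  are the constant 1.\<close>

lemma monic_oprl_unique:
  assumes \<mu>: "nontrivial_prob_on {-1..1} \<mu>" and P: "monic_oprl \<mu> P"
    and Q: "degree Q = n" "lead_coeff Q = 1"
    and orth: "\<And>j. j < n \<Longrightarrow> (\<integral>x. x ^ j * poly Q x \<partial>\<mu>) = 0"
  shows "P n = Q"
proof -
  let ?T = "P n - Q"
  have int: "integrable \<mu> (\<lambda>x. poly r x * poly s x)" for r s
    by (intro integrable_continuous_nontrivial_prob_on[OF \<mu>] continuous_intros) auto
  have Pn: "degree (P n) = n" "coeff (P n) n = 1"
    using P unfolding monic_oprl_def by metis+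
  have monom: "\<forall>m. degree (monom 1 m :: real poly) = m \<and> lead_coeff (monom 1 m :: real poly) = 1"
    by (simp add: degree_monom_eq)
  \<comment> \<open>The monomials form a monic family, so the moment conditions extend to every
    polynomial of degree below n.\<close>
  have *: "(\<integral>x. poly p x * poly Q x \<partial>\<mu>) = 0" if "degree p < n" for p
    using monom that
  proof (induction rule: monic_family_induct)
    case (add c p q)
    have "(\<lambda>x. poly (smult c p + q) x * poly Q x) = (\<lambda>x. c * (poly p x * poly Q x) + poly q x * poly Q x)"
      by (simp add: algebra_simps)
    then show ?case using add int by simp
  qed (use orth in \<open>auto simp: poly_monom degree_monom_eq\<close>)
  have "?T = 0"
  proof (cases "n = 0")
    case True
    then show ?thesis using Pn Q by (metis degree_0_id of_nat_1 eq_iff_diff_eq_0)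
  next
    case False
    have "degree ?T \<le> n" "coeff ?T n = 0" using Pn Q by (auto intro: degree_diff_le)
    with False have "degree ?T < n"
      by (metis coeff_eq_0 degree_0 gr0I leading_coeff_0_iff le_neq_implies_less)
    moreover have square: "(\<lambda>x. poly ?T x * poly ?T x) =
        (\<lambda>x. poly ?T x * poly (P n) x - poly ?T x * poly Q x)"
      by (simp add: algebra_simps)
    ultimately have "(\<integral>x. poly ?T x * poly ?T x \<partial>\<mu>) = 0"
      using *[of ?T] monic_oprl_integral_lower_degree[OF \<mu> P, of ?T n] int[of ?T]
      unfolding square by (simp del: poly_diff)
    then have "AE x in \<mu>. poly ?T x * poly ?T x = 0"
      using int[of ?T ?T] by (subst (asm) integral_nonneg_eq_0_iff_AE) auto
    then show ?thesis by (intro AE_poly_eq_0[OF \<mu>]) (auto elim: eventually_mono)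
  qed
  then show ?thesis by simp
qed

lemma monic_opuc_integral_lower_degree:
  assumes \<sigma>: "nontrivial_prob_on {z. norm z = 1} \<sigma>" and \<Phi>: "monic_opuc \<sigma> \<Phi>" and "degree p < n"
  shows "(\<integral>z. cnj (poly p z) * poly (\<Phi> n) z \<partial>\<sigma>) = 0"
proof -
  have "\<forall>m. degree (\<Phi> m) = m \<and> lead_coeff (\<Phi> m) = 1"
    using \<Phi> unfolding monic_opuc_def by blast
  then show ?thesis using \<open>degree p < n\<close>
  proof (induction rule: monic_family_induct)
    case (add c p q)
    have "integrable \<sigma> (\<lambda>z. cnj (poly r z) * poly (\<Phi> n) z)" for r
      by (intro integrable_continuous_nontrivial_prob_on[OF \<sigma> compact_unit_circle] continuous_intros)
    then show ?case using add by (simp add: distrib_right mult.assoc)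
  qed (use \<Phi> in \<open>auto simp: monic_opuc_def\<close>)
qed

section \<open>The Szego recursion\<close>

lemma cnj_eq_inverse_unit: "norm z = 1 \<Longrightarrow> cnj z = inverse (z :: complex)"
  by (metis complex_norm_square inverse_unique of_real_1 power_one)

lemma cnj_power_mult_unit:
  assumes "norm (z :: complex) = 1"
  shows "z * cnj z = 1" "z ^ n * cnj z ^ n = 1"
  using assms by (simp_all add: complex_norm_square[symmetric] flip: power_mult_distrib)

text \<open>The left side evaluates the polynomial p^*, reversed with respect to the degree of
  \<open>p\<close>; on the circle 1/z is \<open>cnj z\<close>.\<close>

lemma poly_reversed_cnj_unit:
  assumes "norm z = 1"
  shows "poly (reflect_poly (map_poly cnj p)) z = z ^ degree p * cnj (poly p z)"
  using assms
  by (subst poly_reflect_poly_nz)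
    (auto simp: degree_map_poly poly_cnj[symmetric] cnj_eq_inverse_unit[symmetric])

text \<open>The difference \<open>T\<close> of the two sides has degree at most n and is divisible
  by z, so \<open>T\<close> = z \<open>U\<close>. Such a polynomial is orthogonal to each of the
  three terms that make up \<open>T\<close>, hence to itself, and therefore vanishes.\<close>

lemma szego_recursion:
  assumes \<sigma>: "nontrivial_prob_on {z. norm z = 1} \<sigma>" and \<Phi>: "monic_opuc \<sigma> \<Phi>" and z: "norm z = 1"
  shows "poly (\<Phi> (Suc n)) z =
    z * poly (\<Phi> n) z - cnj (verblunsky \<Phi> n) * (z ^ n * cnj (poly (\<Phi> n) z))"
proof -
  define R where "R = reflect_poly (map_poly cnj (\<Phi> n))"
  define T where "T = \<Phi> (Suc n) - pCons 0 (\<Phi> n) + smult (cnj (verblunsky \<Phi> n)) R"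
  have deg: "degree (\<Phi> k) = k" and lc: "coeff (\<Phi> k) k = 1" for k
    using \<Phi> unfolding monic_opuc_def by metis+
  have R: "poly R z = z ^ n * cnj (poly (\<Phi> n) z)" if "norm z = 1" for z
    unfolding R_def by (simp add: poly_reversed_cnj_unit[OF that] deg)
  have degR: "degree R \<le> n"
    unfolding R_def by (rule order_trans[OF degree_reflect_poly_le]) (simp add: degree_map_poly deg)
  have coR: "coeff R 0 = 1"
    unfolding R_def by (simp add: degree_map_poly coeff_map_poly deg lc)
  have int: "integrable \<sigma> (\<lambda>z. cnj (poly p z) * poly q z)" for p q
    by (intro integrable_continuous_nontrivial_prob_on[OF \<sigma> compact_unit_circle] continuous_intros)
  have AE: "AE z in \<sigma>. norm z = 1" using \<sigma> by (simp add: nontrivial_prob_on_def)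
  have degT: "degree T \<le> n"
  proof (rule degree_le, intro allI impI)
    fix i assume "n < i"
    show "coeff T i = 0"
    proof (cases "i = Suc n")
      case True
      then show ?thesis using degR by (simp add: T_def lc coeff_eq_0)
    next
      case False
      with \<open>n < i\<close> have "coeff (\<Phi> (Suc n)) i = 0" "coeff (\<Phi> n) (i - 1) = 0" "coeff R i = 0"
        using degR deg by (auto intro!: coeff_eq_0)
      with \<open>n < i\<close> show ?thesis by (cases i) (auto simp: T_def)
    qed
  qed
  \<comment> \<open>The reversed polynomial has constant term 1, so the choice of the Verblunsky
    coefficient as minus the conjugate of the value at 0 is what cancels the constant term.\<close>
  have "poly T 0 = 0"
    by (simp add: T_def verblunsky_def poly_0_coeff_0 coR)
  then obtain U where U: "T = pCons 0 U" by (cases T) auto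
  have "T = 0"
  \<comment> \<open>Only for nonzero \<open>U\<close> is \<open>degree T\<close> equal to
    \<open>degree U\<close> + 1, which gives \<open>degree U\<close> < n.\<close>
  proof (cases "U = 0")
    case False
    then have degU: "degree U < n" using degT U by simp
    have 1: "(\<integral>z. cnj (poly T z) * poly (\<Phi> (Suc n)) z \<partial>\<sigma>) = 0"
      using degT by (intro monic_opuc_integral_lower_degree[OF \<sigma> \<Phi>]) simp
    \<comment> \<open>On the circle the common factor z of both arguments has modulus 1 and drops
      out of the inner product.\<close>
    have pt: "cnj (poly T z) * poly (pCons 0 (\<Phi> n)) z = cnj (poly U z) * poly (\<Phi> n) z"
      if "norm z = 1" for z
      using cnj_power_mult_unit(1)[OF that]
      by (simp add: U del: mult_cancel_left mult_cancel_right mult_eq_0_iff) algebra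
    have "(\<integral>z. cnj (poly T z) * poly (pCons 0 (\<Phi> n)) z \<partial>\<sigma>) =
        (\<integral>z. cnj (poly U z) * poly (\<Phi> n) z \<partial>\<sigma>)"
      by (intro integral_cong_AE borel_measurable_integrable int)
        (rule eventually_mono[OF AE pt])
    then have 2: "(\<integral>z. cnj (poly T z) * poly (pCons 0 (\<Phi> n)) z \<partial>\<sigma>) = 0"
      using monic_opuc_integral_lower_degree[OF \<sigma> \<Phi> degU] by simp
    have 3: "(\<integral>z. cnj (poly T z) * poly R z \<partial>\<sigma>) = 0"
    proof -
      \<comment> \<open>On the circle z^n \<open>cnj T\<close> = z^(n-1) \<open>cnj U\<close>, which
        is z^(n-1-deg U) times the reversed \<open>U\<close>: a polynomial of degree below n. The
        integral against \<open>R\<close> thus becomes the conjugate of an inner product of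
        \<open>W\<close> with \<open>\<Phi> n\<close>.\<close>
      define W where "W = monom 1 (n - 1 - degree U) * reflect_poly (map_poly cnj U)"
      have "degree W \<le> (n - 1 - degree U) + degree U"
        unfolding W_def using degree_reflect_poly_le[of "map_poly cnj U"]
        by (intro order_trans[OF degree_mult_le] add_mono) (auto simp: degree_monom_eq degree_map_poly)
      then have degW: "degree W < n" using degU by linarith
      have W: "cnj (poly T z) * z ^ n = poly W z" if "norm z = 1" for z
      proof -
        have "z ^ n = z ^ (n - 1 - degree U) * z ^ degree U * z"
          using degU by (simp add: power_add[symmetric] power_Suc2[symmetric] del: power_Suc)
        moreover have "c * u * r = p * (q * u)" if "r = p * q * x" "x * c = 1" for c u r p q x :: complex
          using that by algebra
        ultimately show ?thesis
          using cnj_power_mult_unit(1)[OF that]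
          by (simp only: U W_def poly_monom poly_reversed_cnj_unit[OF that] poly_mult poly_pCons
              complex_cnj_mult add_0 mult_1)
      qed
      have "(\<integral>z. cnj (poly T z) * poly R z \<partial>\<sigma>) = (\<integral>z. cnj (cnj (poly W z) * poly (\<Phi> n) z) \<partial>\<sigma>)"
        by (intro integral_cong_AE borel_measurable_integrable integrable_cnj int
            eventually_mono[OF AE]) (simp add: R W[symmetric] mult.assoc)
      then show ?thesis
        using monic_opuc_integral_lower_degree[OF \<sigma> \<Phi> degW] by (simp del: complex_cnj_mult)
    qed
    have "(\<integral>z. cnj (poly T z) * poly T z \<partial>\<sigma>) = 0"
    proof -
      have "cnj (poly T z) * poly T z = cnj (poly T z) * poly (\<Phi> (Suc n)) z
          - cnj (poly T z) * poly (pCons 0 (\<Phi> n)) z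
          + cnj (verblunsky \<Phi> n) * (cnj (poly T z) * poly R z)" for z
        by (subst (2) T_def) (simp add: algebra_simps)
      then show ?thesis using int[of T] 1 2 3
        by (simp only: Bochner_Integration.integral_add Bochner_Integration.integral_diff
            Bochner_Integration.integrable_diff integrable_mult_right integral_mult_right_zero) simp
    qed
    also have "(\<lambda>z. cnj (poly T z) * poly T z) = (\<lambda>z. complex_of_real ((norm (poly T z))\<^sup>2))"
      by (simp only: complex_norm_square mult.commute)
    finally have "(\<integral>z. (norm (poly T z))\<^sup>2 \<partial>\<sigma>) = 0"
      by (simp only: integral_complex_of_real of_real_eq_0_iff)
    moreover have "integrable \<sigma> (\<lambda>z. (norm (poly T z))\<^sup>2)"
      by (intro integrable_continuous_nontrivial_prob_on[OF \<sigma> compact_unit_circle] continuous_intros)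
    ultimately have "AE z in \<sigma>. (norm (poly T z))\<^sup>2 = 0"
      by (subst (asm) integral_nonneg_eq_0_iff_AE) auto
    then show ?thesis by (intro AE_poly_eq_0[OF \<sigma>]) (auto elim: eventually_mono)
  qed (simp add: U)
  then have "poly T z = 0" by simp
  then show ?thesis by (simp add: T_def R[OF z] algebra_simps)
qed

section \<open>The Geronimus relations\<close>

text \<open>The values at \<open>n\<close> are the recurrence coefficients with index \<open>n + 1\<close>; the first ones are
  the general formula with \<open>\<alpha> (-1) = -1\<close>.\<close>

definition geronimus_b :: "(nat \<Rightarrow> real) \<Rightarrow> nat \<Rightarrow> real" where
  "geronimus_b \<alpha> n = (if n = 0 then \<alpha> 0 else
     1/2 * ((1 - \<alpha> (2*n - 1)) * \<alpha> (2*n) - (1 + \<alpha> (2*n - 1)) * \<alpha> (2*n - 2)))"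

definition geronimus_d :: "(nat \<Rightarrow> real) \<Rightarrow> nat \<Rightarrow> real" where
  "geronimus_d \<alpha> n = (if n = 0 then 1/2 * (1 - (\<alpha> 0)\<^sup>2) * (1 + \<alpha> 1) else
     1/4 * (1 - \<alpha> (2*n - 1)) * (1 - (\<alpha> (2*n))\<^sup>2) * (1 + \<alpha> (2*n + 1)))"

text \<open>The coefficients are stored one index lower: the step to degree n + 2 uses b with index
  n + 2 and d with index n + 1.\<close>

fun geronimus_poly :: "(nat \<Rightarrow> real) \<Rightarrow> nat \<Rightarrow> real poly" where
  "geronimus_poly \<alpha> 0 = 1"
| "geronimus_poly \<alpha> (Suc 0) = [:- geronimus_b \<alpha> 0, 1:]"
| "geronimus_poly \<alpha> (Suc (Suc n)) = [:- geronimus_b \<alpha> (Suc n), 1:] * geronimus_poly \<alpha> (Suc n) -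
     smult (geronimus_d \<alpha> n) (geronimus_poly \<alpha> n)"

lemma geronimus_poly_monic:
  "degree (geronimus_poly \<alpha> n) = n \<and> lead_coeff (geronimus_poly \<alpha> n) = 1"
proof -
  have "degree (geronimus_poly \<alpha> n) \<le> n \<and> coeff (geronimus_poly \<alpha> n) n = 1"
  proof (induction \<alpha> n rule: geronimus_poly.induct)
    case (3 \<alpha> n)
    then show ?case
      by (auto simp: coeff_eq_0 intro!: degree_diff_le degree_add_le order_trans[OF degree_smult_le]
          order_trans[OF degree_pCons_le])
  qed simp_all
  then show ?thesis by (metis le_antisym le_degree zero_neq_one)
qed

text \<open>Algebra at a single point z. With C = X_2n and D = Y_2n, the values S_n, S_(n+1),
  S_(n+2) are tied to linear forms in C and D, and the linear relation among these forms is the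
  three-term recursion.\<close>

lemma geronimus_poly_circle:
  fixes X :: "nat \<Rightarrow> complex"
  assumes z: "norm z = 1" and "X 0 = 1"
    and X: "\<And>n. X (Suc n) = z * X n - of_real (\<alpha> n) * (z ^ n * cnj (X n))"
  shows "(2 * z) ^ n * of_real (poly (geronimus_poly \<alpha> n) (Re z)) =
    (if n = 0 then 1 else z * X (2*n - 1) + z ^ (2*n - 1) * cnj (X (2*n - 1)))"
proof -
  define Y where "Y n = z ^ n * cnj (X n)" for n
  \<comment> \<open>For n = 0 the index truncates to 0 and the general expression would be z + 1.
    The value 1 is half of X_0 + Y_0, in accordance with the convention \<alpha>_(-1) = -1.\<close>
  define S where "S n = (if n = 0 then 1 else z * X (2*n - 1) + Y (2*n - 1))" for n
  have X': "X (Suc n) = z * X n - of_real (\<alpha> n) * Y n" for n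
    by (simp add: X Y_def)
  \<comment> \<open>The conjugated recursion times z^(n+1); the coefficient is real, so conjugation
    leaves it unchanged.\<close>
  have Y': "Y (Suc n) = Y n - of_real (\<alpha> n) * z * X n" for n
  proof -
    have "w * p * (v * x - a * (q * y)) = p * x - a * w * y"
      if "w * v = 1" "p * q = 1" for w v p q x y a :: complex
      using that by algebra
    from this[OF cnj_power_mult_unit(1)[OF z] cnj_power_mult_unit(2)[OF z, of n]] show ?thesis
      by (simp add: Y_def X)
  qed
  \<comment> \<open>2 Re z = z + 1/z on the circle: multiplication by 2z Re z becomes multiplication
    by z^2 + 1.\<close>
  have z2: "2 * z * of_real (Re z) = z\<^sup>2 + 1"
    using complex_add_cnj[of z] cnj_power_mult_unit(1)[OF z] by (simp add: power2_eq_square) algebra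
  have XY0: "X 0 = 1" "Y 0 = 1" by (simp_all add: Y_def assms)
  have S1: "S (Suc 0) = z\<^sup>2 + 1 - 2 * of_real (geronimus_b \<alpha> 0) * z"
    by (simp add: S_def X' Y' XY0 geronimus_b_def power2_eq_square algebra_simps)
  have S2: "S (Suc (Suc n)) = (z\<^sup>2 + 1 - 2 * of_real (geronimus_b \<alpha> (Suc n)) * z) * S (Suc n)
      - 4 * of_real (geronimus_d \<alpha> n) * z\<^sup>2 * S n" for n
  proof -
    define C D where "C = X (2*n)" and "D = Y (2*n)"
    define e c a where "e = complex_of_real (\<alpha> (2*n))" and "c = complex_of_real (\<alpha> (2*n+1))"
      and "a = complex_of_real (\<alpha> (2*n+2))"
    \<comment> \<open>C + D is (1 - \<alpha>_(2n-1)) S_n for n > 0 and 2 for n = 0, which explains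
      the factor 1/2 instead of 1/4 in the first value of \<open>geronimus_d\<close>.\<close>
    have Sn: "4 * of_real (geronimus_d \<alpha> n) * S n = (1 - e\<^sup>2) * (1 + c) * (C + D)"
    proof (cases n)
      case 0
      then show ?thesis by (simp add: S_def geronimus_d_def C_def D_def e_def c_def XY0)
    next
      case (Suc l)
      then have "C + D = (1 - of_real (\<alpha> (2*n-1))) * S n"
        by (simp add: C_def D_def S_def X' Y' algebra_simps)
      then show ?thesis using Suc by (simp add: geronimus_d_def e_def c_def)
    qed
    have b: "2 * of_real (geronimus_b \<alpha> (Suc n)) = (1 - c) * a - (1 + c) * e"
      by (simp add: geronimus_b_def a_def c_def e_def)
    have s1: "S (Suc n) = z * (z * C - e * D) + (D - e * z * C)"
      by (simp add: S_def X' Y' C_def D_def e_def)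
    have s2: "S (Suc (Suc n)) = z * (z * (z * (z * C - e * D) - c * (D - e * z * C))
        - a * ((D - e * z * C) - c * z * (z * C - e * D)))
      + ((D - e * z * C) - c * z * (z * C - e * D)) - a * z * (z * (z * C - e * D) - c * (D - e * z * C))"
      by (simp add: S_def X' Y' C_def D_def e_def c_def a_def)
    show ?thesis
      unfolding s2 s1 b using Sn by algebra
  qed
  have "(2 * z) ^ n * of_real (poly (geronimus_poly \<alpha> n) (Re z)) = S n"
  proof (induction n rule: induct_nat_012)
    case 0
    show ?case by (simp add: S_def)
  next
    case 1
    show ?case unfolding S1 using z2 by (simp add: algebra_simps)
  next
    case (ge2 n)
    have "2 * z * (2 * z * w) * ((x - b) * A - d * B) =
        (z\<^sup>2 + 1 - 2 * b * z) * (2 * z * w * A) - 4 * d * z\<^sup>2 * (w * B)"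
      if "2 * z * x = z\<^sup>2 + 1" for w x b d A B :: complex
      using that by algebra
    from this[OF z2, of "(2 * z) ^ n" "of_real (geronimus_b \<alpha> (Suc n))"
        "of_real (poly (geronimus_poly \<alpha> (Suc n)) (Re z))" "of_real (geronimus_d \<alpha> n)"
        "of_real (poly (geronimus_poly \<alpha> n) (Re z))"]
    show ?case unfolding S2 ge2[symmetric] by (simp add: left_diff_distrib mult.assoc)
  qed
  then show ?thesis by (simp add: S_def Y_def)
qed

section \<open>Orthogonality carried from the circle to the interval\<close>

lemma geronimus_poly_orthogonal:
  assumes \<mu>: "nontrivial_prob_on {-1..1} \<mu>" and \<Phi>: "monic_opuc (Szego \<mu>) \<Phi>"
    and \<alpha>: "\<And>n. verblunsky \<Phi> n = complex_of_real (\<alpha> n)" and "j < n"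
  shows "(\<integral>x. x ^ j * poly (geronimus_poly \<alpha> n) x \<partial>\<mu>) = 0"
proof -
  let ?\<sigma> = "Szego \<mu>" and ?Q = "geronimus_poly \<alpha> n" and ?X = "\<lambda>z. poly (\<Phi> (2*n - 1)) z"
  have \<sigma>: "nontrivial_prob_on {z. norm z = 1} ?\<sigma>" using \<mu> by (rule nontrivial_prob_on_Szego)
  have \<nu>: "prob_space \<mu>" "sets \<mu> = sets borel" "AE x in \<mu>. x \<in> {-1..1}"
    using \<mu> by (auto simp: nontrivial_prob_on_def)
  have AE: "AE z in ?\<sigma>. norm z = 1" using \<sigma> by (simp add: nontrivial_prob_on_def)
  have int: "integrable ?\<sigma> f" if "continuous_on UNIV f"
    for f :: "complex \<Rightarrow> 'b::{banach,second_countable_topology}"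
    by (rule integrable_continuous_nontrivial_prob_on[OF \<sigma> compact_unit_circle that])
  \<comment> \<open>On the circle (Re z)^j \<open>cnj z\<close>^(n-1) is the conjugate of ((1 +
    z^2)/2)^j z^(n-1-j). Its degree is at most n - 1 + j, hence below 2n - 1 because j < n.\<close>
  define q where "q = smult (1 / 2 ^ j) ([:1, 0, 1:] ^ j * monom 1 (n - 1 - j) :: complex poly)"
  have degq: "degree q < 2*n - 1"
  proof -
    have "degree ([:1, 0, 1:] ^ j :: complex poly) \<le> 2 * j"
      using degree_power_le[of "[:1, 0, 1:] :: complex poly" j] by simp
    then have "degree q \<le> 2 * j + (n - 1 - j)"
      unfolding q_def
      by (intro order_trans[OF degree_smult_le] order_trans[OF degree_mult_le])
        (simp add: degree_monom_eq)
    then show ?thesis using \<open>j < n\<close> by linarith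
  qed
  have X0: "poly (\<Phi> 0) z = 1" for z
    using \<Phi> unfolding monic_opuc_def by (metis degree_0_id poly_1 of_nat_1 one_pCons)
  have pt: "Re z ^ j * poly ?Q (Re z) = 2 / 2 ^ n * Re (cnj (poly q z) * ?X z)" if z: "norm z = 1" for z
  proof -
    have "(2 * z) ^ n * of_real (poly ?Q (Re z)) = z * ?X z + z ^ (2*n - 1) * cnj (?X z)"
      using geronimus_poly_circle[of z "\<lambda>k. poly (\<Phi> k) z" \<alpha> n] z X0 \<open>j < n\<close>
        szego_recursion[OF \<sigma> \<Phi> z] \<alpha> by simp
    moreover have "p * (t * A) = p * (q * x + r * y)"
      if "t * p * A = w * x + p * r * y" "w = p * q" for p t A q x r y w :: complex
      using that by algebra
    \<comment> \<open>Extracting z^n from both summands leaves a number plus its conjugate, so 2^n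
      Q_n(Re z) is twice a real part.\<close>
    moreover have "z ^ (2*n - 1) = z ^ n * z ^ (n - 1)" "z = z ^ n * cnj z ^ (n - 1)"
      using \<open>j < n\<close> cnj_power_mult_unit(2)[OF z, of "n - 1"]
      by (cases n; simp add: power_add[symmetric] mult_2)+
    ultimately have "z ^ n * (2 ^ n * complex_of_real (poly ?Q (Re z))) =
        z ^ n * (cnj z ^ (n-1) * ?X z + z ^ (n-1) * cnj (?X z))"
      by (simp only: power_mult_distrib)
    then have "2 ^ n * complex_of_real (poly ?Q (Re z)) = cnj z ^ (n-1) * ?X z + z ^ (n-1) * cnj (?X z)"
      using z by (auto simp del: of_real_mult)
    then have "complex_of_real (2 ^ n * poly ?Q (Re z)) =
        cnj z ^ (n-1) * ?X z + cnj (cnj z ^ (n-1) * ?X z)"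
      by simp
    then have 1: "2 ^ n * poly ?Q (Re z) = 2 * Re (cnj z ^ (n-1) * ?X z)"
      unfolding complex_add_cnj of_real_eq_iff .
    have "(z + cnj z) * cnj z = 1 + cnj z * cnj z"
      using cnj_power_mult_unit(1)[OF z] by (simp add: algebra_simps)
    then have "complex_of_real (Re z) * cnj z = (1 + cnj z * cnj z) / 2"
      by (simp add: complex_add_cnj field_simps)
    then have "complex_of_real (Re z) ^ j * cnj z ^ j = (1 + cnj z * cnj z) ^ j / 2 ^ j"
      by (simp only: power_divide[symmetric] power_mult_distrib[symmetric])
    moreover have "cnj z ^ (n - 1) = cnj z ^ j * cnj z ^ (n - 1 - j)"
      using \<open>j < n\<close> by (simp add: power_add[symmetric])
    ultimately have 2: "complex_of_real (Re z ^ j) * cnj z ^ (n - 1) = cnj (poly q z)"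
      by (simp add: q_def poly_monom mult.assoc[symmetric])
    have "Re z ^ j * Re (cnj z ^ (n-1) * ?X z) = Re (cnj (poly q z) * ?X z)"
      unfolding 2[symmetric] mult.assoc by simp
    moreover have "B * A = 2 / 2 ^ n * C" if "2 ^ n * A = 2 * R" "B * R = C" for A B C R :: real
      using that by (auto simp: field_simps)
    ultimately show ?thesis using 1 by blast
  qed
  have "(\<integral>x. x ^ j * poly ?Q x \<partial>\<mu>) = (\<integral>x. x ^ j * poly ?Q x \<partial>distr ?\<sigma> borel Re)"
    by (simp only: distr_Re_Szego[OF \<nu>])
  also have "\<dots> = (\<integral>z. Re z ^ j * poly ?Q (Re z) \<partial>?\<sigma>)"
    by (intro integral_distr borel_measurable_continuous_onI continuous_intros)
      (simp cong: measurable_cong_sets)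
  also have "\<dots> = (\<integral>z. 2 / 2 ^ n * Re (cnj (poly q z) * ?X z) \<partial>?\<sigma>)"
    using AE by (intro integral_cong_AE borel_measurable_integrable int continuous_intros)
      (auto elim!: eventually_mono simp: pt)
  also have "\<dots> = 2 / 2 ^ n * Re (\<integral>z. cnj (poly q z) * ?X z \<partial>?\<sigma>)"
    by (simp only: integral_mult_right_zero)
      (intro arg_cong2[where f = "(*)"] refl integral_Re int continuous_intros)
  also have "\<dots> = 0"
    using monic_opuc_integral_lower_degree[OF \<sigma> \<Phi> degq] by simp
  finally show ?thesis .
qed

text \<open>By uniqueness the orthogonal polynomials are the \<open>geronimus_poly\<close>.
  Subtracting the two recursions leaves a combination of two consecutive monic polynomials, so both
  of its coefficients vanish.\<close>

theorem geronimus_relations: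
  assumes \<mu>: "nontrivial_prob_on {-1..1} \<mu>" and "recurrence_coeffs \<mu> b d"
    and \<Phi>: "monic_opuc (Szego \<mu>) \<Phi>" and \<alpha>: "\<And>n. verblunsky \<Phi> n = complex_of_real (\<alpha> n)"
  shows "b (n + 1) = geronimus_b \<alpha> n" and "d (n + 1) = geronimus_d \<alpha> n"
proof -
  obtain P where P: "monic_oprl \<mu> P"
    and rec: "\<And>n. P (n + 1) = [:- b (n + 1), 1:] * P n - smult (d n) (if n = 0 then 0 else P (n - 1))"
    using assms(2) unfolding recurrence_coeffs_def by blast
  have PQ: "P n = geronimus_poly \<alpha> n" for n
    using geronimus_poly_monic geronimus_poly_orthogonal[OF \<mu> \<Phi> \<alpha>]
    by (intro monic_oprl_unique[OF \<mu> P]) blast+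
  have deg: "degree (P k) = k" and lc: "coeff (P k) k = 1" for k
    using P unfolding monic_oprl_def by metis+
  have b0: "b 1 = geronimus_b \<alpha> 0"
    using rec[of 0] by (simp add: PQ)
  have step: "smult (geronimus_b \<alpha> (Suc n) - b (Suc (Suc n))) (P (Suc n)) +
      smult (geronimus_d \<alpha> n - d (Suc n)) (P n) = 0" for n
    using rec[of "Suc n"] by (simp add: PQ algebra_simps smult_diff_left)
  \<comment> \<open>The coefficient of degree n + 1 sees only \<open>P (Suc n)\<close> and fixes b;
    after that, the coefficient of degree n fixes d.\<close>
  have bs: "b (Suc (Suc n)) = geronimus_b \<alpha> (Suc n)" for n
    using arg_cong[OF step[of n], of "\<lambda>p. coeff p (Suc n)"] by (simp add: lc deg coeff_eq_0)
  then have "d (Suc n) = geronimus_d \<alpha> n" for n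
    using arg_cong[OF step[of n], of "\<lambda>p. coeff p n"] by (simp add: lc)
  then show "d (n + 1) = geronimus_d \<alpha> n" by simp
  show "b (n + 1) = geronimus_b \<alpha> n"
    using b0 bs by (cases n) simp_all
qed

text \<open>Both measures obey the Geronimus relations. An even shift k = 2m of the Verblunsky
  sequence keeps the parity of indices, so from n = m + 1 on the coefficients of
  \<open>\<mu>\<close> return with index lowered by m; an odd shift exchanges parities, and the
  values stay expressed in \<open>\<alpha>\<close>.\<close>

theorem theorem7:
  fixes \<mu> \<mu>' :: "real measure" and \<sigma> :: "complex measure"
    and b d b' d' \<alpha> \<xi> :: "nat \<Rightarrow> real" and \<Phi> :: "nat \<Rightarrow> complex poly" and k m :: nat
  assumes "nontrivial_prob_on {-1..1} \<mu>"
    and "recurrence_coeffs \<mu> b d"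
    and "\<sigma> = Szego \<mu>"
    and "verblunsky_coeffs \<sigma> (\<lambda>n. complex_of_real (\<alpha> n))"
    and "k \<ge> 1"
    and "\<And>n. n < k \<Longrightarrow> -1 < \<xi> n \<and> \<xi> n < 1"
    and "nontrivial_prob_on {-1..1} \<mu>'"
    and "monic_opuc (Szego \<mu>') \<Phi>"
    and "\<And>n. verblunsky \<Phi> n = complex_of_real (anti_associated_verblunsky k \<xi> \<alpha> n)"
    and "recurrence_coeffs \<mu>' b' d'"
    and "m \<ge> 1"
  shows "(k = 2 * m - 1 \<longrightarrow>
      (\<forall>n. d' (n + 1) =
        (if n = 0 then 1/2 * (1 - (\<xi> 0)\<^sup>2) * (1 + (if m \<ge> 2 then \<xi> 1 else \<alpha> 0))
         else if n + 2 \<le> m then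
           1/4 * (1 - \<xi> (2*n - 1)) * (1 - (\<xi> (2*n))\<^sup>2) * (1 + \<xi> (2*n + 1))
         else if n + 1 = m then
           1/4 * (1 - \<xi> (2*n - 1)) * (1 - (\<xi> (2*n))\<^sup>2) * (1 + \<alpha> (2*n + 2 - 2*m))
         else
           1/4 * (1 - \<alpha> (2*(n - m))) * (1 - (\<alpha> (2*(n - m) + 1))\<^sup>2) * (1 + \<alpha> (2*(n - m) + 2)))) \<and>
      (\<forall>n. b' (n + 1) =
        (if n = 0 then \<xi> 0
         else if n < m then
           1/2 * ((1 - \<xi> (2*n - 1)) * \<xi> (2*n) - (1 + \<xi> (2*n - 1)) * \<xi> (2*n - 2))
         else if n = m then
           1/2 * ((1 - \<alpha> (2*(n - m))) * \<alpha> (2*(n - m) + 1) - (1 + \<alpha> (2*(n - m))) * \<xi> (2*n - 2))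
         else
           1/2 * ((1 - \<alpha> (2*(n - m))) * \<alpha> (2*(n - m) + 1)
                  - (1 + \<alpha> (2*(n - m))) * \<alpha> (2*(n - m) - 1))))) \<and>
    (k = 2 * m \<longrightarrow>
      (\<forall>n. d' (n + 1) =
        (if n = 0 then 1/2 * (1 - (\<xi> 0)\<^sup>2) * (1 + \<xi> 1)
         else if n < m then
           1/4 * (1 - \<xi> (2*n - 1)) * (1 - (\<xi> (2*n))\<^sup>2) * (1 + \<xi> (2*n + 1))
         else if n = m then
           1/4 * (1 - \<xi> (2*n - 1)) * (1 - (\<alpha> (2*(n - m)))\<^sup>2) * (1 + \<alpha> (2*(n - m) + 1))
         else d (n - m + 1))) \<and>
      (\<forall>n. b' (n + 1) =
        (if n = 0 then \<xi> 0
         else if n < m then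
           1/2 * ((1 - \<xi> (2*n - 1)) * \<xi> (2*n) - (1 + \<xi> (2*n - 1)) * \<xi> (2*n - 2))
         else if n = m then
           1/2 * ((1 - \<xi> (2*n - 1)) * \<alpha> (2*(n - m)) - (1 + \<xi> (2*n - 1)) * \<xi> (2*n - 2))
         else b (n - m + 1))))"
proof -
  define \<beta> where "\<beta> = anti_associated_verblunsky k \<xi> \<alpha>"
  obtain \<Psi> where \<Psi>: "monic_opuc (Szego \<mu>) \<Psi>" "\<And>n. verblunsky \<Psi> n = complex_of_real (\<alpha> n)"
    using assms(3,4) unfolding verblunsky_coeffs_def by metis
  note G = geronimus_relations[OF assms(1,2) \<Psi>]
  note G' = geronimus_relations[OF assms(7,10,8), of \<beta>, unfolded \<beta>_def, OF assms(9), folded \<beta>_def]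
  have lo: "\<beta> i = \<xi> i" if "i < k" for i
    using that by (simp add: \<beta>_def anti_associated_verblunsky_def)
  have hi: "\<beta> i = \<alpha> l" if "k \<le> i" "i - k = l" for i l
    using that by (simp add: \<beta>_def anti_associated_verblunsky_def)
  show ?thesis
  proof (intro conjI impI allI)
    assume k: "k = 2 * m - 1"
    fix n
    \<comment> \<open>The third index is written \<open>2*n + 2 - 2*m\<close> because n = m - 1 must
      give 0, whereas \<open>2*(n - m) + 2\<close> would truncate to 2.\<close>
    have \<beta>: "\<beta> (2*n - 1) = (if n < m then \<xi> (2*n - 1) else \<alpha> (2*(n - m)))"
      "\<beta> (2*n) = (if n < m then \<xi> (2*n) else \<alpha> (2*(n - m) + 1))"
      "\<beta> (2*n + 1) = (if n + 1 < m then \<xi> (2*n + 1) else \<alpha> (2*n + 2 - 2*m))"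
      "\<beta> (2*n - 2) = (if n \<le> m then \<xi> (2*n - 2) else \<alpha> (2*(n - m) - 1))"
      using k \<open>m \<ge> 1\<close> by (auto intro!: lo hi)
    show "d' (n + 1) = (if n = 0 then 1/2 * (1 - (\<xi> 0)\<^sup>2) * (1 + (if m \<ge> 2 then \<xi> 1 else \<alpha> 0))
         else if n + 2 \<le> m then
           1/4 * (1 - \<xi> (2*n - 1)) * (1 - (\<xi> (2*n))\<^sup>2) * (1 + \<xi> (2*n + 1))
         else if n + 1 = m then
           1/4 * (1 - \<xi> (2*n - 1)) * (1 - (\<xi> (2*n))\<^sup>2) * (1 + \<alpha> (2*n + 2 - 2*m))
         else
           1/4 * (1 - \<alpha> (2*(n - m))) * (1 - (\<alpha> (2*(n - m) + 1))\<^sup>2) * (1 + \<alpha> (2*(n - m) + 2)))"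
    proof -
      have "2*n + 2 - 2*m = 2*(n - m) + 2" if "m \<le> n"
        using that by simp
      then show ?thesis
        using \<beta> \<open>m \<ge> 1\<close> unfolding G'(2) geronimus_d_def by auto
    qed
    show "b' (n + 1) = (if n = 0 then \<xi> 0
         else if n < m then
           1/2 * ((1 - \<xi> (2*n - 1)) * \<xi> (2*n) - (1 + \<xi> (2*n - 1)) * \<xi> (2*n - 2))
         else if n = m then
           1/2 * ((1 - \<alpha> (2*(n - m))) * \<alpha> (2*(n - m) + 1) - (1 + \<alpha> (2*(n - m))) * \<xi> (2*n - 2))
         else
           1/2 * ((1 - \<alpha> (2*(n - m))) * \<alpha> (2*(n - m) + 1)
                  - (1 + \<alpha> (2*(n - m))) * \<alpha> (2*(n - m) - 1)))"
      using \<beta> \<open>m \<ge> 1\<close> unfolding G'(1) geronimus_b_def by auto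
  next
    assume k: "k = 2 * m"
    fix n
    \<comment> \<open>For n > m these are the values of \<open>\<alpha>\<close> in the general
      Geronimus formulas at n - m. At n = m the entry \<open>\<xi> (2*m - 1)\<close> stands in the
      place of \<alpha>_(-1) = -1, so this case is separate.\<close>
    have \<beta>: "\<beta> (2*n - 1) = (if n \<le> m then \<xi> (2*n - 1) else \<alpha> (2*(n - m) - 1))"
      "\<beta> (2*n) = (if n < m then \<xi> (2*n) else \<alpha> (2*(n - m)))"
      "\<beta> (2*n + 1) = (if n < m then \<xi> (2*n + 1) else \<alpha> (2*(n - m) + 1))"
      "\<beta> (2*n - 2) = (if n \<le> m then \<xi> (2*n - 2) else \<alpha> (2*(n - m) - 2))"
      using k \<open>m \<ge> 1\<close> by (auto intro!: lo hi)
    show "d' (n + 1) = (if n = 0 then 1/2 * (1 - (\<xi> 0)\<^sup>2) * (1 + \<xi> 1)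
         else if n < m then
           1/4 * (1 - \<xi> (2*n - 1)) * (1 - (\<xi> (2*n))\<^sup>2) * (1 + \<xi> (2*n + 1))
         else if n = m then
           1/4 * (1 - \<xi> (2*n - 1)) * (1 - (\<alpha> (2*(n - m)))\<^sup>2) * (1 + \<alpha> (2*(n - m) + 1))
         else d (n - m + 1))"
      using \<beta> \<open>m \<ge> 1\<close> unfolding G'(2) G(2) geronimus_d_def by auto
    show "b' (n + 1) = (if n = 0 then \<xi> 0
         else if n < m then
           1/2 * ((1 - \<xi> (2*n - 1)) * \<xi> (2*n) - (1 + \<xi> (2*n - 1)) * \<xi> (2*n - 2))
         else if n = m then
           1/2 * ((1 - \<xi> (2*n - 1)) * \<alpha> (2*(n - m)) - (1 + \<xi> (2*n - 1)) * \<xi> (2*n - 2))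
         else b (n - m + 1))"
      using \<beta> \<open>m \<ge> 1\<close> unfolding G'(1) G(1) geronimus_b_def by auto
  qed
qed

end
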